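(* Let $q$ be a prime power with $q\equiv3\pmod 4$ and let $d$ be an odd positive integer with $q\equiv-1\pmod d$. Let $m=\nu_2(q^2-1)$ (so $m\ge 3$). Let $\gamma$ be a primitive $d$-th root of unity in $\mathbb{F}_{q^2}$, let $\delta_j=\gamma^j+\gamma^{qj}$, and for each $k\le m$ let $\beta_{2^k}$ be a primitive $2^k$-th root of unity in $\mathbb{F}_{q^2}$. Put $\theta_{i,j,k}=\beta_{2^k}^{2i-1}\gamma^j+\beta_{2^k}^{q(2i-1)}\gamma^{qj}$ and $\theta_{i,j}=\beta_{2^m}^{2i-1}\gamma^j+\beta_{2^m}^{q(2i-1)}\gamma^{qj}$. (i) If $2\le n\le m-1$, then $x^{2^nd}-1$ is the product of $2^{n-1}d+1$ irreducible factors over $\mathbb{F}_q$ given by $$x^{2^nd}-1=(x-1)(x+1)\prod_{j=1}^{(d-1)/2}\left(x^2\pm\delta_jx+1\right)\prod_{k=2}^{n}\prod_{i=1}^{2^{k-2}}\prod_{j=0}^{d-1}\left(x^2-\theta_{i,j,k}x+1\right).$$ (ii) If $n\ge m$, then $x^{2^nd}-1$ is the product of $2^{m-2}d(n-m+2)+1$ irreducible factors over $\mathbb{F}_q$ given by $$x^{2^nd}-1=(x^{2^{m-1}d}-1)\prod_{r=0}^{n-m}\prod_{i=1}^{2^{m-3}}\prod_{j=0}^{d-1}\left(x^{2^{r+1}}\pm\theta_{i,j}x^{2^r}-1\right),$$ where $x^{2^{m-1}d}-1$ is factored into irreducibles as in (i) with $n=m-1$.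
   Context: $\nu_2(l)$ is the exponent of the largest power of $2$ dividing $l$. Notation: $(x^2\pm ux+v)$ denotes $(x^2+ux+v)(x^2-ux+v)$, and $(x^{2^{r+1}}\pm ux^{2^r}-1)$ denotes $(x^{2^{r+1}}+ux^{2^r}-1)(x^{2^{r+1}}-ux^{2^r}-1)$. *)

theory Defs
  imports
    "Subresultants.More_Homomorphisms"
    "HOL-Library.Cardinality"
    "HOL-Number_Theory.Cong"
    "HOL-Number_Theory.Prime_Powers"
begin

definition primitive_root_of_unity :: "nat \<Rightarrow> 'a::field \<Rightarrow> bool" where
  "primitive_root_of_unity n x \<longleftrightarrow>
     n > 0 \<and> x ^ n = 1 \<and> (\<forall>k. 0 < k \<and> k < n \<longrightarrow> x ^ k \<noteq> 1)"

text \<open>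
  The two multisets below list, with repetition, the factors of the explicit factorizations of
  \<open>x ^ (2 ^ n * d) - 1\<close> for \<open>n < m\<close> and for \<open>n \<ge> m\<close>. They make the number of factors a
  well-defined quantity; the product formulas for them follow the definitions.
  A pair \<open>(x\<^sup>2 \<plusminus> u x + v)\<close> contributes its two factors separately.
\<close>

definition low_factors ::
    "(nat \<Rightarrow> 'a::field) \<Rightarrow> (nat \<Rightarrow> nat \<Rightarrow> nat \<Rightarrow> 'a) \<Rightarrow> nat \<Rightarrow> nat \<Rightarrow> 'a poly multiset" where
  "low_factors \<delta> \<theta> d n =
     {#[:-1, 1:], [:1, 1:]#}
     + (\<Sum>j = 1..(d - 1) div 2. {#[:1, \<delta> j, 1:], [:1, - \<delta> j, 1:]#})
     + (\<Sum>k = 2..n. \<Sum>i = 1..2 ^ (k - 2). \<Sum>j = 0..<d. {#[:1, - \<theta> i j k, 1:]#})"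

definition high_factors ::
    "(nat \<Rightarrow> 'a::field) \<Rightarrow> (nat \<Rightarrow> nat \<Rightarrow> nat \<Rightarrow> 'a) \<Rightarrow> nat \<Rightarrow> nat \<Rightarrow> nat \<Rightarrow> 'a poly multiset" where
  "high_factors \<delta> \<theta> d m n =
     low_factors \<delta> \<theta> d (m - 1)
     + (\<Sum>r = 0..n - m. \<Sum>i = 1..2 ^ (m - 3). \<Sum>j = 0..<d.
          {#monom 1 (2 ^ (r + 1)) + monom (\<theta> i j m) (2 ^ r) - 1,
            monom 1 (2 ^ (r + 1)) - monom (\<theta> i j m) (2 ^ r) - 1#})"

lemma prod_mset_sum_mset_family:
  fixes F :: "'b \<Rightarrow> 'c::comm_monoid_mult multiset"
  shows "prod_mset (\<Sum>x\<in>A. F x) = (\<Prod>x\<in>A. prod_mset (F x))"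
  by (induction A rule: infinite_finite_induct) auto

lemma prod_mset_low_factors:
  "prod_mset (low_factors \<delta> \<theta> d n) =
     [:-1, 1:] * [:1, 1:]
     * (\<Prod>j = 1..(d - 1) div 2. [:1, \<delta> j, 1:] * [:1, - \<delta> j, 1:])
     * (\<Prod>k = 2..n. \<Prod>i = 1..2 ^ (k - 2). \<Prod>j = 0..<d. [:1, - \<theta> i j k, 1:])"
  unfolding low_factors_def
  by (simp only: prod_mset_Un prod_mset_sum_mset_family prod_mset.add_mset prod_mset.empty mult_1_right)

lemma prod_mset_high_factors:
  "prod_mset (high_factors \<delta> \<theta> d m n) =
     prod_mset (low_factors \<delta> \<theta> d (m - 1))
     * (\<Prod>r = 0..n - m. \<Prod>i = 1..2 ^ (m - 3). \<Prod>j = 0..<d.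
          (monom 1 (2 ^ (r + 1)) + monom (\<theta> i j m) (2 ^ r) - 1)
          * (monom 1 (2 ^ (r + 1)) - monom (\<theta> i j m) (2 ^ r) - 1))"
  unfolding high_factors_def
  by (simp only: prod_mset_Un prod_mset_sum_mset_family prod_mset.add_mset prod_mset.empty mult_1_right)

end

theory Submission
  imports "HOL-Algebra.Algebraic_Closure_Type" "HOL-Number_Theory.Residues" Defs
begin

text \<open>
  Work in the algebraic closure of the larger field. Irreducibility over the field with \<open>q\<close> elements
  follows from the Frobenius orbits: every root \<open>z\<close> of a divisor brings along \<open>z ^ (q ^ s)\<close> for all
  \<open>s\<close>, and these are distinct for \<open>s < deg f\<close>, so no divisor has smaller positive degree. For
  the factors in \<open>x ^ (2 ^ r)\<close> one has \<open>z ^ (2 ^ (m - 1 + r) * d) = - 1\<close>, while \<open>2 ^ (m + r)\<close> does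
  not divide \<open>q ^ s - 1\<close> for \<open>0 < s < 2 ^ (r + 1)\<close>.

  For the products, \<open>\<beta> ^ q\<close> is \<open>1 / \<beta>\<close> for \<open>\<beta>\<close> of order \<open>2 ^ k\<close> with \<open>k < m\<close>, but \<open>- 1 / \<beta>\<close> for \<open>k = m\<close>.
  With \<open>a = \<beta> ^ (2 * i - 1) * \<gamma> ^ j\<close> the factors are therefore \<open>(x - a) * (x - 1 / a)\<close> in the first case,
  and in the second a \<open>\<plusminus>\<close> pair multiplies to \<open>(y\<^sup>2 - a\<^sup>2) * (y\<^sup>2 - 1 / a\<^sup>2)\<close> with \<open>y = x ^ (2 ^ r)\<close>,
  which is the first case for \<open>\<beta>\<^sup>2\<close> and \<open>\<gamma>\<^sup>2\<close>. Each block multiplies to some \<open>x ^ (2 ^ t * d) + 1\<close>, and these telescope.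
\<close>

section \<open>Frobenius orbits and irreducibility\<close>

text \<open>Multiplication by a nonzero \<open>x\<close> permutes the nonzero elements, so their
  product absorbs one factor \<open>x\<close> per element; cancelling it leaves \<open>x\<close>
  raised to the group order equal to 1.\<close>

lemma finite_field_power_card:
  fixes x :: "'a::{field,finite}"
  shows "x ^ CARD('a) = x"
proof (cases "x = 0")
  case False
  let ?U = "UNIV - {0::'a}"
  have "bij_betw ((*) x) ?U ?U"
    by (rule bij_betwI[where g = "(*) (inverse x)"]) (use False in \<open>auto simp: field_simps\<close>)
  then have "(\<Prod>y\<in>?U. x * y) = \<Prod>?U"
    by (rule prod.reindex_bij_betw)
  then have "x ^ card ?U * \<Prod>?U = \<Prod>?U"
    by (simp add: prod.distrib)
  then have "x ^ card ?U = 1" by simp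
  moreover have "CARD('a) = Suc (card ?U)"
    by (simp add: card_Suc_Diff1)
  ultimately show ?thesis by (simp only: power_Suc mult_1_right)
qed (simp add: power_0_left)

lemma CHAR_of_primepow_card:
  assumes "prime p" "CARD('a::{field,finite}) = p ^ e"
  shows "CHAR('a) = p"
proof -
  have "prime CHAR('a)"
    by (intro prime_CHAR_semidom finite_imp_CHAR_pos) simp
  moreover have "CHAR('a) dvd p ^ e"
    using CHAR_dvd_CARD[where 'a = 'a] assms by simp
  ultimately show ?thesis
    using assms(1) prime_dvd_power[of "CHAR('a)" p e] primes_dvd_imp_eq[of "CHAR('a)" p] by simp
qed

text \<open>The image lies among the roots of \<open>X ^ CARD('k) - X\<close>, which has at most
  \<open>CARD('k)\<close> roots, and by injectivity the image already has that many elements. This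
  is what lets traces descend to the small field.\<close>

lemma range_field_hom_eq_frobenius_fixed:
  fixes \<iota> :: "'k::{field,finite} \<Rightarrow> 'l::field"
  assumes "field_hom \<iota>"
  shows "range \<iota> = {y. y ^ CARD('k) = y}"
proof (rule card_subset_eq)
  interpret field_hom \<iota> by fact
  let ?p = "monom 1 CARD('k) - monom 1 1 :: 'l poly"
  have card2: "2 \<le> CARD('k)"
  proof -
    have "card {0, 1 :: 'k} \<le> CARD('k)" by (rule card_mono) auto
    then show ?thesis by simp
  qed
  then have deg: "degree ?p = CARD('k)"
    by (subst diff_conv_add_uminus, subst degree_add_eq_left) (auto simp: degree_monom_eq)
  then have "?p \<noteq> 0" using card2 by auto
  moreover have roots: "{y. poly ?p y = 0} = {y. y ^ CARD('k) = y}"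
    by (simp add: poly_monom)
  ultimately show fin: "finite {y::'l. y ^ CARD('k) = y}"
    using poly_roots_finite by metis
  have "card {y::'l. y ^ CARD('k) = y} \<le> CARD('k)"
    using card_poly_roots_bound[OF \<open>?p \<noteq> 0\<close>] roots deg by simp
  moreover have inj: "card (range \<iota>) = CARD('k)"
    by (simp add: card_image inj_f)
  show sub: "range \<iota> \<subseteq> {y. y ^ CARD('k) = y}"
    by (auto simp flip: hom_power simp: finite_field_power_card)
  ultimately show "card (range \<iota>) = card {y::'l. y ^ CARD('k) = y}"
    using inj card_mono[OF fin sub] by simp
qed

text \<open>Frobenius is additive and multiplicative and fixes the coefficients, so it passes
  through evaluation; in particular it sends roots to roots.\<close>

lemma poly_map_poly_frobenius:
  fixes \<phi> :: "'k::field \<Rightarrow> 'b::field"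
  assumes "\<phi> 0 = 0"
    and frob: "\<And>x y :: 'b. (x + y) ^ q = x ^ q + y ^ q"
    and fixed: "\<And>c. \<phi> c ^ q = \<phi> c"
  shows "poly (map_poly \<phi> g) (z ^ q) = poly (map_poly \<phi> g) z ^ q"
proof (induction g)
  case 0
  then show ?case using fixed[of 0] assms(1) by simp
next
  case (pCons a g)
  then show ?case
    using assms by (simp add: map_poly_pCons power_mult_distrib)
qed

lemma diff_power_frobenius:
  fixes x y :: "'b::field"
  assumes "\<And>x y :: 'b. (x + y) ^ q = x ^ q + y ^ q"
  shows "(x - y) ^ q = x ^ q - y ^ q"
  using assms[of "x - y" y] by (simp add: algebra_simps)

lemma frobenius_power_eq_cancel:
  fixes z :: "'b::field"
  assumes frob: "\<And>x y :: 'b. (x + y) ^ q = x ^ q + y ^ q"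
    and eq: "z ^ (q ^ (i + s)) = z ^ (q ^ i)"
  shows "z ^ (q ^ s) = z"
  using eq
proof (induction i)
  case (Suc i)
  \<comment> \<open>Frobenius is injective: the \<open>q\<close>-th power of a difference is the
    difference of the \<open>q\<close>-th powers, and a field has no nonzero nilpotents.\<close>
  have "(z ^ (q ^ (i + s)) - z ^ (q ^ i)) ^ q = 0"
    using Suc.prems by (simp add: diff_power_frobenius[OF frob] power_mult power_add mult_ac flip: power_mult)
  then show ?case using Suc.IH by (auto simp: power_eq_0_iff)
qed simp

text \<open>The orbit condition is asked at the roots of \<open>f\<close>, yet it bounds every
  nonconstant divisor \<open>g\<close>: a root of \<open>g\<close> is a root of \<open>f\<close>,
  and its first \<open>degree f\<close> Frobenius images are distinct roots of
  \<open>g\<close>.\<close>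

lemma irreducible_if_frobenius_orbits_long:
  fixes \<phi> :: "'k::field \<Rightarrow> 'b::alg_closed_field" and f :: "'k poly"
  assumes hom: "field_hom \<phi>"
    and frob: "\<And>x y :: 'b. (x + y) ^ q = x ^ q + y ^ q"
    and fixed: "\<And>c. \<phi> c ^ q = \<phi> c"
    and deg: "degree f > 0"
    and long: "\<And>z s. poly (map_poly \<phi> f) z = 0 \<Longrightarrow> 0 < s \<Longrightarrow> s < degree f \<Longrightarrow> z ^ (q ^ s) \<noteq> z"
  shows "irreducible f"
proof -
  interpret field_hom \<phi> by fact
  interpret P: map_poly_inj_idom_hom \<phi> ..
  have big: "degree g \<ge> degree f" if g: "g dvd f" "degree g > 0" for g
  proof -
    let ?G = "map_poly \<phi> g"
    have "degree ?G > 0" using g by simp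
    then obtain z where z: "poly ?G z = 0"
      using alg_closed_imp_poly_has_root by blast
    have orbit: "poly ?G (z ^ (q ^ i)) = 0" for i
    proof (induction i)
      case (Suc i)
      \<comment> \<open>For \<open>q = 0\<close> the hypothesis \<open>fixed\<close> at 0 would read
        \<open>1 = 0\<close>, since \<open>0 ^ 0 = 1\<close>.\<close>
      have q: "q > 0"
        using fixed[of 0] by (cases q) auto
      have "z ^ q ^ Suc i = (z ^ q ^ i) ^ q" by (simp add: mult.commute flip: power_mult)
      then show ?case using Suc q
        by (simp add: poly_map_poly_frobenius[where q = q, OF _ frob fixed] power_0_left)
    qed (use z in simp)
    have zf: "poly (map_poly \<phi> f) z = 0"
      using g z by (auto simp: dvd_def P.hom_mult)
    have "inj_on (\<lambda>i. z ^ (q ^ i)) {..<degree f}"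
    proof (rule linorder_inj_onI')
      fix i j assume ij: "i \<in> {..<degree f}" "j \<in> {..<degree f}" "i < j"
      show "z ^ (q ^ i) \<noteq> z ^ (q ^ j)"
        using frobenius_power_eq_cancel[OF frob, of z i "j - i"] long[OF zf, of "j - i"] ij by auto
    qed
    then have "degree f = card ((\<lambda>i. z ^ (q ^ i)) ` {..<degree f})"
      by (simp add: card_image)
    also have "\<dots> \<le> card {x. poly ?G x = 0}"
      using \<open>degree ?G > 0\<close> orbit by (intro card_mono poly_roots_finite) auto
    also have "\<dots> \<le> degree g"
      using \<open>degree ?G > 0\<close> card_poly_roots_bound[of ?G] by force
    finally show ?thesis .
  qed
  show ?thesis
  proof (rule irreducibleI)
    show "f \<noteq> 0" using deg by auto
    show "\<not> f dvd 1" using deg by (simp add: poly_dvd_1)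
    fix a b assume ab: "f = a * b"
    then have "degree f = degree a + degree b"
      using deg by (intro trans[OF _ degree_mult_eq]) auto
    moreover have "a \<noteq> 0" "b \<noteq> 0" using ab deg by auto
    ultimately show "a dvd 1 \<or> b dvd 1"
      using big[of a] ab by (cases "degree a = 0") (auto simp: is_unit_iff_degree)
  qed
qed

section \<open>Products over roots of unity\<close>

text \<open>Indices \<open>i\<close> and \<open>i + 2 ^ k\<close> give opposite odd powers, so their
  two factors combine to a difference of squares; this is the same product for
  \<open>Y\<^sup>2\<close> and \<open>c\<^sup>2\<close> with half as many terms. A ring is allowed
  because \<open>Y\<close> and \<open>c\<close> will be polynomials.\<close>

lemma prod_odd_powers:
  fixes c Y :: "'a::comm_ring_1"
  assumes "c ^ (2 ^ k) = - 1"
  shows "(\<Prod>i = 1..2 ^ k. Y - c ^ (2 * i - 1)) = Y ^ (2 ^ k) + 1"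
  using assms
proof (induction k arbitrary: c Y)
  case (Suc k)
  have shift: "c ^ (2 * (i + 2 ^ k) - 1) = - (c ^ (2 * i - 1))" if "i \<in> {1..2 ^ k}" for i
  proof -
    have "2 * (i + 2 ^ k) - 1 = 2 ^ Suc k + (2 * i - 1)" using that by auto
    then show ?thesis using Suc.prems by (simp only: power_add) simp
  qed
  have "(\<Prod>i = 1..2 ^ Suc k. Y - c ^ (2 * i - 1))
      = (\<Prod>i = 1..2 ^ k. Y - c ^ (2 * i - 1)) * (\<Prod>i = 1 + 2 ^ k..2 ^ k + 2 ^ k. Y - c ^ (2 * i - 1))"
    using prod.ub_add_nat[of 1 "2 ^ k" "\<lambda>i. Y - c ^ (2 * i - 1)" "2 ^ k"]
    by (simp add: mult_2 add.commute)
  also have "(\<Prod>i = 1 + 2 ^ k..2 ^ k + 2 ^ k. Y - c ^ (2 * i - 1))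
      = (\<Prod>i = 1..2 ^ k. Y + c ^ (2 * i - 1))"
    by (subst prod.shift_bounds_cl_nat_ivl) (intro prod.cong refl, simp only: shift diff_minus_eq_add)
  also have "(\<Prod>i = 1..2 ^ k. Y - c ^ (2 * i - 1)) * (\<Prod>i = 1..2 ^ k. Y + c ^ (2 * i - 1))
      = (\<Prod>i = 1..2 ^ k. Y\<^sup>2 - (c\<^sup>2) ^ (2 * i - 1))"
    unfolding prod.distrib[symmetric]
    by (intro prod.cong refl) (simp add: power2_eq_square power_mult_distrib algebra_simps)
  also have "\<dots> = (Y\<^sup>2) ^ (2 ^ k) + 1"
    using Suc.prems by (intro Suc.IH) (simp flip: power_mult)
  finally show ?case by (simp flip: power_mult)
qed simp

text \<open>Since \<open>c ^ (2 ^ (k + 2)) = 1\<close>, the inverse of an odd power is again an odd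
  power of \<open>c\<close>: the inverses of the lower half of the odd powers are exactly the upper
  half.\<close>

lemma prod_odd_powers_inverse_pairs:
  fixes c c' Y :: "'a::comm_ring_1"
  assumes inv: "c * c' = 1" and c: "c ^ (2 ^ Suc k) = - 1"
  shows "(\<Prod>i = 1..2 ^ k. (Y - c ^ (2 * i - 1)) * (Y - c' ^ (2 * i - 1))) = Y ^ (2 ^ Suc k) + 1"
proof -
  have reflect: "c' ^ (2 * i - 1) = c ^ (2 * (2 ^ Suc k + 1 - i) - 1)" if "i \<in> {1..2 ^ k}" for i
  proof -
    have "c ^ (2 * 2 ^ Suc k) = 1"
      using c by (simp only: mult.commute[of 2] power_mult) simp
    moreover have "2 * 2 ^ Suc k = (2 * i - 1) + (2 * (2 ^ Suc k + 1 - i) - 1)"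
      using that by auto
    ultimately have one: "c ^ (2 * i - 1) * c ^ (2 * (2 ^ Suc k + 1 - i) - 1) = 1"
      by (simp only: flip: power_add)
    have "c' ^ (2 * i - 1) = c' ^ (2 * i - 1) * (c ^ (2 * i - 1) * c ^ (2 * (2 ^ Suc k + 1 - i) - 1))"
      by (simp only: one mult_1_right)
    also have "\<dots> = (c * c') ^ (2 * i - 1) * c ^ (2 * (2 ^ Suc k + 1 - i) - 1)"
      by (simp only: power_mult_distrib mult_ac)
    finally show ?thesis by (simp only: inv power_one mult_1_left)
  qed
  \<comment> \<open>The reflection \<open>2 ^ Suc k + 1 - i\<close> exchanges the lower and the
    upper half of the index range.\<close>
  have "(\<Prod>i = 1..2 ^ k. Y - c' ^ (2 * i - 1)) = (\<Prod>i = 2 ^ k + 1..2 ^ k + 2 ^ k. Y - c ^ (2 * i - 1))"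
    by (rule prod.reindex_bij_witness[where i = "\<lambda>i. 2 ^ Suc k + 1 - i" and j = "\<lambda>i. 2 ^ Suc k + 1 - i"])
      (use reflect in auto)
  then have "(\<Prod>i = 1..2 ^ k. (Y - c ^ (2 * i - 1)) * (Y - c' ^ (2 * i - 1)))
      = (\<Prod>i = 1..2 ^ Suc k. Y - c ^ (2 * i - 1))"
    using prod.ub_add_nat[of 1 "2 ^ k" "\<lambda>i. Y - c ^ (2 * i - 1)" "2 ^ k"]
    by (simp add: prod.distrib mult_2)
  then show ?thesis using prod_odd_powers[OF c] by simp
qed

lemma primitive_root_of_unity_power_inj:
  assumes "primitive_root_of_unity d \<gamma>"
  shows "inj_on (\<lambda>j. \<gamma> ^ j) {0..<d}"
proof (rule linorder_inj_onI')
  fix i j assume ij: "i \<in> {0..<d}" "j \<in> {0..<d}" "i < j"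
  have "\<gamma> \<noteq> 0" using assms by (auto simp: primitive_root_of_unity_def power_0_left)
  moreover have "\<gamma> ^ j = \<gamma> ^ i * \<gamma> ^ (j - i)"
    using ij by (simp flip: power_add)
  moreover have "\<gamma> ^ (j - i) \<noteq> 1"
    using assms ij by (auto simp: primitive_root_of_unity_def)
  ultimately show "\<gamma> ^ i \<noteq> \<gamma> ^ j" by simp
qed

text \<open>Both sides have degree at most \<open>d\<close>, agree in the coefficient of
  \<open>x ^ d\<close>, and vanish at the \<open>d\<close> distinct powers of \<gamma>.\<close>

lemma prod_primitive_root_linear_factors:
  fixes \<gamma> :: "'a::field"
  assumes "primitive_root_of_unity d \<gamma>"
  shows "(\<Prod>j = 0..<d. [:- (\<gamma> ^ j), 1:]) = monom 1 d - 1"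
proof (rule poly_eqI_degree_lead_coeff[where A = "(\<lambda>j. \<gamma> ^ j) ` {0..<d}" and n = d])
  have d: "d > 0" "\<gamma> ^ d = 1" using assms by (auto simp: primitive_root_of_unity_def)
  show "degree (\<Prod>j = 0..<d. [:- (\<gamma> ^ j), 1:]) \<le> d"
    by (rule order.trans[OF degree_prod_sum_le]) auto
  show "degree (monom 1 d - 1 :: 'a poly) \<le> d"
    by (rule degree_diff_le) (auto simp: degree_monom_le)
  have "coeff (\<Prod>j = 0..<d. [:- (\<gamma> ^ j), 1:]) (\<Sum>j = 0..<d. degree [:- (\<gamma> ^ j), 1:])
      = (\<Prod>j = 0..<d. lead_coeff [:- (\<gamma> ^ j), 1:])"
    using lead_coeff_prod[of "\<lambda>j. [:- (\<gamma> ^ j), 1:]" "{0..<d}"]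
    by (simp add: degree_prod_eq_sum_degree)
  then show "coeff (\<Prod>j = 0..<d. [:- (\<gamma> ^ j), 1:]) d = coeff (monom 1 d - 1 :: 'a poly) d"
    using d by simp
  show "d \<le> card ((\<lambda>j. \<gamma> ^ j) ` {0..<d})"
    using primitive_root_of_unity_power_inj[OF assms] by (simp add: card_image)
  fix z assume "z \<in> (\<lambda>j. \<gamma> ^ j) ` {0..<d}"
  then obtain j where j: "j < d" "z = \<gamma> ^ j" by auto
  have "z ^ d = (\<gamma> ^ d) ^ j" by (simp only: j power_mult[symmetric] mult.commute)
  then have "z ^ d = 1" using d by simp
  then show "poly (\<Prod>j = 0..<d. [:- (\<gamma> ^ j), 1:]) z = poly (monom 1 d - 1) z"
    using j by (auto simp: poly_prod poly_monom prod_zero_iff)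
qed

lemma prod_primitive_root_scaled:
  fixes \<gamma> c :: "'a::field" and p :: "'a poly"
  assumes "primitive_root_of_unity d \<gamma>"
  shows "(\<Prod>j = 0..<d. p - [:c * \<gamma> ^ j:]) = p ^ d - [:c:] ^ d"
proof (cases "c = 0")
  case True
  then show ?thesis using assms by (simp add: primitive_root_of_unity_def power_0_left)
next
  case False
  \<comment> \<open>Homogenization: substitute \<open>p / c\<close> into the factorization of
    \<open>x ^ d - 1\<close> and multiply by \<open>c ^ d\<close>.\<close>
  let ?Y = "smult (inverse c) p"
  have "p - [:c * \<gamma> ^ j:] = [:c:] * pcompose [:- (\<gamma> ^ j), 1:] ?Y" for j
    using False by (simp add: pcompose_pCons smult_add_right)
  then have "(\<Prod>j = 0..<d. p - [:c * \<gamma> ^ j:]) = [:c:] ^ d * pcompose (\<Prod>j = 0..<d. [:- (\<gamma> ^ j), 1:]) ?Y"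
    by (simp only: prod.distrib pcompose_prod) simp
  also have "\<dots> = [:c:] ^ d * (?Y ^ d - 1)"
    unfolding prod_primitive_root_linear_factors[OF assms]
    by (simp add: pcompose_diff monom_altdef pcompose_hom.hom_power pcompose_pCons)
  also have "\<dots> = ([:c:] * ?Y) ^ d - [:c:] ^ d"
    by (simp only: power_mult_distrib right_diff_distrib mult_1_right)
  also have "[:c:] * ?Y = p" using False by simp
  finally show ?thesis .
qed

lemma primitive_root_of_unity_inverse:
  fixes \<gamma> \<gamma>' :: "'a::field"
  assumes "primitive_root_of_unity d \<gamma>" "\<gamma> * \<gamma>' = 1"
  shows "primitive_root_of_unity d \<gamma>'"
proof -
  have "\<gamma>' ^ k = 1 \<longleftrightarrow> \<gamma> ^ k = 1" for k
    using assms(2) by (metis mult_1_left mult_1_right power_mult_distrib power_one)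
  then show ?thesis using assms(1) by (simp add: primitive_root_of_unity_def)
qed

text \<open>If \<open>(\<gamma>\<^sup>2) ^ k = 1\<close> with \<open>0 < k < d\<close>, then
  \<open>2 * k\<close> lies strictly between 0 and \<open>2 * d\<close> and differs from the odd
  \<open>d\<close>, so either \<open>2 * k\<close> or \<open>2 * k - d\<close> is a positive
  exponent below \<open>d\<close> that kills \<gamma>.\<close>

lemma primitive_root_of_unity_square:
  fixes \<gamma> :: "'a::field"
  assumes "primitive_root_of_unity d \<gamma>" "odd d"
  shows "primitive_root_of_unity d (\<gamma>\<^sup>2)"
proof -
  have "(\<gamma>\<^sup>2) ^ k \<noteq> 1" if k: "0 < k" "k < d" for k
  proof
    assume "(\<gamma>\<^sup>2) ^ k = 1"
    then have eq: "\<gamma> ^ (2 * k) = 1" by (simp add: power_mult)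
    then have "\<not> 2 * k < d" using assms k by (auto simp: primitive_root_of_unity_def)
    moreover have "2 * k \<noteq> d" using assms by auto
    ultimately have *: "0 < 2 * k - d" "2 * k - d < d" "2 * k = d + (2 * k - d)" using k by auto
    have "\<gamma> ^ (2 * k - d) = 1"
      using eq assms(1) by (subst (asm) *(3)) (simp add: power_add primitive_root_of_unity_def)
    with * show False using assms(1) by (auto simp: primitive_root_of_unity_def)
  qed
  then show ?thesis
    using assms by (auto simp: primitive_root_of_unity_def simp flip: power_mult)
      (simp add: mult.commute power_mult)
qed

text \<open>The product over \<open>j\<close> turns \<open>p - b ^ e * \<gamma> ^ j\<close> into
  \<open>p ^ d - (b ^ d) ^ e\<close>, and the product over \<open>i\<close> is then one over odd
  powers of \<open>b ^ d\<close>. Used with \<open>p = x\<close> for the first factorization and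
  \<open>p = x ^ (2 ^ (r + 1))\<close> for the second.\<close>

lemma prod_inverse_pairs:
  fixes \<gamma> \<gamma>' b b' :: "'a::field" and p :: "'a poly"
  assumes \<gamma>: "primitive_root_of_unity d \<gamma>" "\<gamma> * \<gamma>' = 1" and "odd d"
    and b: "b * b' = 1" "b ^ (2 ^ Suc k) = - 1"
  shows "(\<Prod>i = 1..2 ^ k. \<Prod>j = 0..<d.
            (p - [:b ^ (2 * i - 1) * \<gamma> ^ j:]) * (p - [:b' ^ (2 * i - 1) * \<gamma>' ^ j:]))
         = p ^ (2 ^ Suc k * d) + 1"
proof -
  note \<gamma>' = primitive_root_of_unity_inverse[OF \<gamma>]
  let ?c = "[:b:] ^ d" and ?c' = "[:b':] ^ d"
  have one: "[:b:] * [:b':] = 1"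
    using b(1) by (simp add: mult.commute)
  have inv: "?c * ?c' = 1"
    by (simp only: one power_mult_distrib[symmetric] power_one)
  have "[:b:] ^ (2 ^ Suc k) = - 1"
    by (simp only: poly_const_pow b(2) one_pCons minus_pCons minus_zero)
  \<comment> \<open>Raising -1 to the odd power \<open>d\<close> keeps it -1.\<close>
  then have c: "?c ^ (2 ^ Suc k) = - 1"
    using \<open>odd d\<close> by (simp only: power_mult[symmetric] mult.commute[of d]) (simp only: power_mult, simp)
  have "(\<Prod>j = 0..<d. (p - [:b ^ e * \<gamma> ^ j:]) * (p - [:b' ^ e * \<gamma>' ^ j:]))
      = (p ^ d - ?c ^ e) * (p ^ d - ?c' ^ e)" for e
    unfolding prod.distrib prod_primitive_root_scaled[OF \<gamma>(1)] prod_primitive_root_scaled[OF \<gamma>']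
    by (simp only: poly_const_pow[symmetric] power_mult[symmetric] mult.commute)
  then have "(\<Prod>i = 1..2 ^ k. \<Prod>j = 0..<d.
      (p - [:b ^ (2 * i - 1) * \<gamma> ^ j:]) * (p - [:b' ^ (2 * i - 1) * \<gamma>' ^ j:]))
      = (p ^ d) ^ (2 ^ Suc k) + 1"
    by (simp only: prod_odd_powers_inverse_pairs[OF inv c])
  then show ?thesis by (simp only: power_mult[symmetric] mult.commute)
qed

text \<open>The exponent 0 contributes \<open>p - 1\<close>; the others pair up as \<open>j\<close>
  and \<open>d - j\<close>, and \<open>\<gamma> ^ (d - j)\<close> is the inverse of
  \<open>\<gamma> ^ j\<close>.\<close>

lemma power_odd_minus_one_eq_prod:
  fixes \<gamma> \<gamma>' :: "'a::field" and p :: "'a poly"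
  assumes \<gamma>: "primitive_root_of_unity d \<gamma>" "\<gamma> * \<gamma>' = 1" and "odd d"
  shows "p ^ d - 1 = (p - 1) * (\<Prod>j = 1..(d - 1) div 2. (p - [:\<gamma> ^ j:]) * (p - [:\<gamma>' ^ j:]))"
proof -
  obtain h where h: "d = 2 * h + 1" using \<open>odd d\<close> by (elim oddE)
  have reflect: "\<gamma>' ^ j = \<gamma> ^ (d - j)" if "j < d" for j
  proof -
    have "\<gamma> ^ j * \<gamma> ^ (d - j) = 1"
      using \<gamma>(1) that by (simp add: primitive_root_of_unity_def flip: power_add)
    moreover have "\<gamma>' ^ j * \<gamma> ^ j = 1"
      using \<gamma>(2) by (simp add: mult.commute flip: power_mult_distrib)
    ultimately show ?thesis by (metis mult.assoc mult_1_left mult_1_right)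
  qed
  have "p ^ d - 1 = (\<Prod>j = 0..<d. p - [:\<gamma> ^ j:])"
    using prod_primitive_root_scaled[OF \<gamma>(1), of p 1] by (simp flip: one_pCons)
  also have "{0..<d} = insert 0 {1..h + h}" using h by auto
  also have "(\<Prod>j\<in>\<dots>. p - [:\<gamma> ^ j:]) = (p - 1) * (\<Prod>j = 1..h + h. p - [:\<gamma> ^ j:])"
    by (simp flip: one_pCons)
  also have "(\<Prod>j = 1..h + h. p - [:\<gamma> ^ j:])
      = (\<Prod>j = 1..h. p - [:\<gamma> ^ j:]) * (\<Prod>j = h + 1..h + h. p - [:\<gamma> ^ j:])"
    by (rule prod.ub_add_nat) simp
  also have "(\<Prod>j = h + 1..h + h. p - [:\<gamma> ^ j:]) = (\<Prod>j = 1..h. p - [:\<gamma>' ^ j:])"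
    by (rule prod.reindex_bij_witness[where i = "\<lambda>j. d - j" and j = "\<lambda>j. d - j"])
      (use reflect h in auto)
  finally show ?thesis using h by (simp add: prod.distrib)
qed

section \<open>Two-adic valuation of \<open>q ^ s - 1\<close>\<close>

text \<open>Write \<open>s = 2 ^ e * u\<close> with \<open>u\<close> odd, so
  \<open>e \<le> r\<close>. The odd part adds no factor 2, and from \<open>q\<^sup>2 - 1\<close> on
  each squaring adds exactly one, so \<open>q ^ s - 1\<close> has too few factors 2.\<close>

lemma not_two_power_dvd_power_minus_one:
  fixes q :: int
  assumes q: "q mod 4 = 3" and m: "m \<ge> 2" "\<not> 2 ^ Suc m dvd q\<^sup>2 - 1"
    and s: "0 < s" "s < 2 ^ Suc r"
  shows "\<not> 2 ^ (m + r) dvd q ^ s - 1"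
proof
  assume dvd: "2 ^ (m + r) dvd q ^ s - 1"
  have "odd q" using q by presburger
  have odd_exponent: "2 ^ t dvd a - 1" if "2 ^ t dvd a ^ u - 1" "odd u" "odd a" for a :: int and t u
  proof -
    \<comment> \<open>An odd number of odd terms.\<close>
    have "odd (\<Sum>i<u. a ^ i)" using that by (induction u) (auto simp: even_sum_iff)
    then have "coprime (2 ^ t) (\<Sum>i<u. a ^ i)" by simp
    moreover have "a ^ u - 1 = (a - 1) * (\<Sum>i<u. a ^ i)" by (rule power_diff_1_eq)
    ultimately show ?thesis using that(1) by (simp add: coprime_dvd_mult_left_iff)
  qed
  have doubling: "\<not> 2 ^ (m + Suc e) dvd q ^ (2 ^ Suc e) - 1" for e
  proof (induction e)
    case 0
    show ?case using m by simp
  next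
    case (Suc e)
    define y where "y = q ^ (2 ^ e)"
    have "odd y" using \<open>odd q\<close> by (simp add: y_def)
    then obtain w where w: "y = 2 * w + 1" by (elim oddE)
    \<comment> \<open>For odd \<open>y\<close> the factor \<open>y\<^sup>2 + 1\<close> is twice an
      odd number, hence a gain of a single factor 2.\<close>
    have "y\<^sup>2 + 1 = 2 * (2 * (w\<^sup>2 + w) + 1)" by (simp add: w power2_eq_square algebra_simps)
    moreover have "q ^ (2 ^ Suc (Suc e)) = (y\<^sup>2)\<^sup>2"
      by (simp add: y_def mult.commute flip: power_mult)
    then have "q ^ (2 ^ Suc (Suc e)) - 1 = (y\<^sup>2 - 1) * (y\<^sup>2 + 1)"
      by (simp add: algebra_simps power2_eq_square)
    ultimately have eq: "q ^ (2 ^ Suc (Suc e)) - 1 = 2 * ((y\<^sup>2 - 1) * (2 * (w\<^sup>2 + w) + 1))" by simp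
    have "y\<^sup>2 = q ^ (2 ^ Suc e)" by (simp add: y_def mult.commute flip: power_mult)
    then have "\<not> 2 ^ (m + Suc e) dvd y\<^sup>2 - 1" using Suc by simp
    moreover have "coprime (2 ^ (m + Suc e)) (2 * (w\<^sup>2 + w) + 1)" by simp
    moreover have "(2::int) ^ (m + Suc (Suc e)) = 2 * 2 ^ (m + Suc e)" by simp
    ultimately show ?case
      unfolding eq by (simp only: dvd_mult_cancel_left coprime_dvd_mult_left_iff) simp
  qed
  define e where "e = multiplicity 2 s"
  obtain u where eu: "s = 2 ^ e * u" "odd u"
    using multiplicity_decompose'[of s 2] s(1) unfolding e_def by auto
  have "u > 0" using s(1) eu by (cases u) auto
  then have "2 ^ e \<le> s" using eu by simp
  then have "2 ^ e < (2::nat) ^ Suc r" using s(2) by (rule order.strict_trans1)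
  then have "e < Suc r" by (rule power_less_imp_less_exp[rotated]) simp
  then have "e \<le> r" by simp
  have "2 ^ (m + r) dvd (q ^ (2 ^ e)) ^ u - 1"
    using dvd eu(1) by (simp only: power_mult)
  then have dvd': "2 ^ (m + r) dvd q ^ (2 ^ e) - 1"
    using eu(2) by (rule odd_exponent) (use \<open>odd q\<close> in simp)
  show False
  proof (cases e)
    case 0
    \<comment> \<open>For odd \<open>s\<close> no squaring is available; instead
      \<open>q - 1\<close> is 2 modulo 4 while \<open>m + r\<close> is at least 2.\<close>
    have "(4::int) dvd 2 ^ (m + r)" using le_imp_power_dvd[of 2 "m + r" "2::int"] m by simp
    then have "4 dvd q - 1" using dvd' 0 by (auto intro: dvd_trans)
    then show False using q by presburger
  next
    case (Suc e')
    have "(2::int) ^ (m + Suc e') dvd 2 ^ (m + r)" using \<open>e \<le> r\<close> Suc by (intro le_imp_power_dvd) simp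
    then show False using doubling[of e'] dvd' Suc dvd_trans by blast
  qed
qed

text \<open>The order of \<open>z\<close> is a multiple of \<open>2 ^ Suc t\<close>. Otherwise, with
  \<open>u\<close> the odd part of \<open>N\<close>, the exponent \<open>2 ^ t * d * u\<close> would
  be a multiple of \<open>N\<close>, making \<open>(- 1) ^ u\<close> equal to 1.\<close>

lemma power_ne_one_if_two_power_eq_minus_one:
  fixes z :: "'a::field"
  assumes "z ^ (2 ^ t * d) = - 1" "(1::'a) \<noteq> - 1" "\<not> 2 ^ Suc t dvd N"
  shows "z ^ N \<noteq> 1"
proof
  assume z: "z ^ N = 1"
  have "N \<noteq> 0" using assms(3) by (metis dvd_0_right)
  define e where "e = multiplicity 2 N"
  obtain u where eu: "N = 2 ^ e * u" "odd u"
    using multiplicity_decompose'[of N 2] \<open>N \<noteq> 0\<close> unfolding e_def by auto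
  have "e \<le> t"
  proof (rule ccontr)
    assume "\<not> e \<le> t"
    then have "(2::nat) ^ Suc t dvd 2 ^ e" by (intro le_imp_power_dvd) simp
    then show False using assms(3) eu by simp
  qed
  then have "2 ^ t * d * u = N * (2 ^ (t - e) * d)"
    by (simp add: eu flip: power_add)
  then have "(z ^ (2 ^ t * d)) ^ u = (z ^ N) ^ (2 ^ (t - e) * d)"
    by (metis power_mult)
  then show False using assms eu z by simp
qed

section \<open>The factorization over the algebraic closure\<close>

lemma power_two_power_telescope:
  fixes y :: "'a::comm_ring_1"
  shows "(y ^ (2 ^ M) - 1) * (\<Prod>r<N. y ^ (2 ^ (M + r)) + 1) = y ^ (2 ^ (M + N)) - 1"
proof (induction N)
  case (Suc N)
  have "y ^ (2 ^ (M + Suc N)) = (y ^ (2 ^ (M + N)))\<^sup>2"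
    by (simp add: mult.commute flip: power_mult)
  then have "(y ^ (2 ^ (M + N)) - 1) * (y ^ (2 ^ (M + N)) + 1) = y ^ (2 ^ (M + Suc N)) - 1"
    by (simp add: algebra_simps power2_eq_square)
  then show ?case
    by (simp only: prod.lessThan_Suc mult.assoc[symmetric] Suc.IH)
qed simp

lemma inverse_pair:
  fixes b b' g g' :: "'a::comm_monoid_mult"
  assumes "b * b' = 1" "g * g' = 1"
  shows "(b ^ e * g ^ j) * (b' ^ e * g' ^ j) = 1"
proof -
  have "(b ^ e * g ^ j) * (b' ^ e * g' ^ j) = (b * b') ^ e * (g * g') ^ j"
    by (simp only: power_mult_distrib mult_ac)
  then show ?thesis by (simp only: assms power_one mult_1_left)
qed

lemma inverse_power_eq_minus_one:
  fixes a a' :: "'a::field"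
  assumes "a * a' = 1" "a ^ n = - 1"
  shows "a' ^ n = - 1"
proof -
  have "a ^ n * a' ^ n = 1" by (simp only: assms(1) power_one flip: power_mult_distrib)
  then have "- (a' ^ n) = 1" by (simp only: assms(2) mult_minus_left mult_1_left)
  then show ?thesis by (metis minus_minus)
qed

text \<open>Coefficients live in \<open>'k\<close>, all roots in \<open>'b\<close>. An algebraically
  closed field is used because for \<open>r > 0\<close> the roots of the factors in
  \<open>x ^ (2 ^ r)\<close> lie outside the field with \<open>q\<^sup>2\<close> elements; that
  field survives only through \<gamma> and \<beta>, already mapped into \<open>'b\<close>.\<close>

locale frobenius_setting =
  fixes \<phi> :: "'k::{field,finite} \<Rightarrow> 'b::alg_closed_field"
    and q d m :: nat and \<gamma> :: 'b and \<beta> :: "nat \<Rightarrow> 'b"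
    and \<delta> :: "nat \<Rightarrow> 'k" and \<theta> :: "nat \<Rightarrow> nat \<Rightarrow> nat \<Rightarrow> 'k"
  assumes hom: "field_hom \<phi>"
    and card: "CARD('k) = q"
    and frob: "\<And>x y :: 'b. (x + y) ^ q = x ^ q + y ^ q"
    and q_mod_4: "q mod 4 = 3"
    and odd_d: "odd d"
    and d_dvd: "d dvd q + 1"
    and m_def: "m = multiplicity 2 (q\<^sup>2 - 1)"
    and \<gamma>: "primitive_root_of_unity d \<gamma>"
    and \<beta>: "\<And>k. k \<le> m \<Longrightarrow> primitive_root_of_unity (2 ^ k) (\<beta> k)"
    and \<delta>: "\<And>j. \<phi> (\<delta> j) = \<gamma> ^ j + \<gamma> ^ (q * j)"
    and \<theta>: "\<And>i j k. i \<ge> 1 \<Longrightarrow> k \<le> m \<Longrightarrow>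
          \<phi> (\<theta> i j k) = \<beta> k ^ (2 * i - 1) * \<gamma> ^ j + \<beta> k ^ (q * (2 * i - 1)) * \<gamma> ^ (q * j)"
begin

sublocale field_hom \<phi> by (fact hom)
sublocale P: map_poly_inj_idom_hom \<phi> ..

lemma frobenius_fixed: "\<phi> c ^ q = \<phi> c"
  using finite_field_power_card[of c] card by (simp flip: hom_power)

text \<open>For \<open>q = 4 * t + 3\<close> the factor \<open>q - 1\<close> is twice an odd number,
  so all but one of the \<open>m\<close> factors 2 of \<open>q\<^sup>2 - 1\<close> sit in
  \<open>q + 1\<close>, which is divisible by 4.\<close>

lemma m_props: "3 \<le> m" "\<exists>w. odd w \<and> q + 1 = 2 ^ (m - 1) * w" "\<not> 2 ^ Suc m dvd q\<^sup>2 - 1"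
proof -
  define t where "t = q div 4"
  have q: "q = 4 * t + 3" using q_mod_4 by (simp add: t_def) presburger
  have eq: "q\<^sup>2 - 1 = 2 * ((2 * t + 1) * (q + 1))"
    by (simp add: q power2_eq_square algebra_simps)
  have "multiplicity 2 ((2 * t + 1) * (q + 1)) = multiplicity 2 (q + 1)"
    by (rule multiplicity_prime_elem_times_other) auto
  then have "multiplicity 2 (q\<^sup>2 - 1) = Suc (multiplicity 2 (q + 1))"
    unfolding eq by (subst multiplicity_times_same) simp_all
  then have mult: "multiplicity 2 (q + 1) = m - 1" "m \<ge> 1" by (simp_all add: m_def)
  have "(2::nat) ^ 2 dvd q + 1" by (simp add: q)
  then have "2 \<le> multiplicity 2 (q + 1)" by (intro multiplicity_geI) auto
  then show "3 \<le> m" using mult by simp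
  show "\<exists>w. odd w \<and> q + 1 = 2 ^ (m - 1) * w"
    using multiplicity_decompose'[of "q + 1" 2] unfolding mult by auto
  have "q\<^sup>2 - 1 \<noteq> 0" unfolding eq by simp
  then show "\<not> 2 ^ Suc m dvd q\<^sup>2 - 1"
    by (subst power_dvd_iff_le_multiplicity) (simp_all add: m_def)
qed

lemma \<beta>_half:
  assumes "1 \<le> k" "k \<le> m"
  shows "\<beta> k ^ (2 ^ (k - 1)) = - 1"
proof -
  have "2 ^ k = 2 ^ (k - 1) * (2::nat)" using assms by (cases k) auto
  then have "(\<beta> k ^ (2 ^ (k - 1)))\<^sup>2 = 1" "\<beta> k ^ (2 ^ (k - 1)) \<noteq> 1"
    using \<beta>[OF assms(2)] by (auto simp: primitive_root_of_unity_def simp flip: power_mult)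
  then show ?thesis by (simp add: power2_eq_1_iff)
qed

text \<open>The odd characteristic is read off from \<open>\<beta> 1\<close>, which is -1 but, being
  of order 2, is not 1.\<close>

lemma one_neq_minus_one: "(1::'b) \<noteq> - 1"
proof -
  have "\<beta> 1 = - 1" using \<beta>_half[of 1] m_props(1) by simp
  moreover have "\<beta> 1 \<noteq> 1" using \<beta>[of 1] m_props(1) by (auto simp: primitive_root_of_unity_def dest: spec[of _ 1])
  ultimately show ?thesis by metis
qed

lemma \<gamma>_inverse: "\<gamma> * \<gamma> ^ q = 1"
proof -
  obtain t where "q + 1 = d * t" using d_dvd by auto
  then have "\<gamma> ^ (q + 1) = 1" using \<gamma> by (simp only: power_mult primitive_root_of_unity_def power_one)
  then show ?thesis by simp
qed

lemma \<beta>_inverse: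
  assumes "1 \<le> k" "k \<le> m - 1"
  shows "\<beta> k * \<beta> k ^ q = 1"
proof -
  have "2 ^ k dvd (2::nat) ^ (m - 1)" using assms by (simp add: le_imp_power_dvd)
  then have "2 ^ k dvd q + 1" using m_props(2) by (metis dvd_mult2)
  then obtain t where "q + 1 = 2 ^ k * t" by auto
  moreover have "k \<le> m" using assms by simp
  ultimately have "\<beta> k ^ (q + 1) = 1" using \<beta>[of k] by (simp only: power_mult primitive_root_of_unity_def power_one)
  then show ?thesis by simp
qed

text \<open>Since \<open>q + 1\<close> is \<open>2 ^ (m - 1)\<close> times an odd number and
  \<open>\<beta> m ^ (2 ^ (m - 1)) = - 1\<close>, the norm \<open>\<beta> m ^ (q + 1)\<close> is -1.
  This sign is the source of the constant term -1 in the factors for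
  \<open>n \<ge> m\<close>.\<close>

lemma \<beta>_top_inverse: "\<beta> m * - (\<beta> m ^ q) = 1"
proof -
  obtain w where w: "odd w" "q + 1 = 2 ^ (m - 1) * w" using m_props(2) by blast
  have "\<beta> m ^ (q + 1) = (- 1) ^ w"
    using \<beta>_half[of m] m_props(1) by (simp only: w power_mult)
  then show ?thesis using w by simp
qed

lemma frobenius_power_neq:
  assumes z: "z ^ (2 ^ t * d) = - 1" and "\<not> 2 ^ Suc t dvd q ^ s - 1"
  shows "z ^ (q ^ s) \<noteq> (z::'b)"
proof
  assume eq: "z ^ (q ^ s) = z"
  have "q > 0" using q_mod_4 by (cases q) auto
  then have "q ^ s = Suc (q ^ s - 1)" by simp
  then have "z * z ^ (q ^ s - 1) = z * 1" using eq by (metis power_Suc mult_1_right)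
  moreover have "z \<noteq> 0" using z odd_d by (cases "d = 0") (auto simp: power_0_left)
  ultimately show False
    using power_ne_one_if_two_power_eq_minus_one[OF z one_neq_minus_one assms(2)] by simp
qed

lemma not_two_power_dvd:
  assumes "0 < s" "s < 2 ^ Suc r"
  shows "\<not> 2 ^ Suc (m - 1 + r) dvd q ^ s - 1"
proof
  have "q > 0" using q_mod_4 by (cases q) auto
  \<comment> \<open>Positivity of \<open>q\<close> makes the truncated subtraction on naturals a
    true one, so the integer valuation bound applies.\<close>
  then have conv: "int (q ^ e - 1) = int q ^ e - 1" for e by (simp add: of_nat_diff)
  assume "2 ^ Suc (m - 1 + r) dvd q ^ s - 1"
  then have "int (2 ^ Suc (m - 1 + r)) dvd int (q ^ s - 1)" by (simp only: of_nat_dvd_iff)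
  moreover have "Suc (m - 1 + r) = m + r" using m_props(1) by simp
  ultimately have "2 ^ (m + r) dvd int q ^ s - 1" by (simp only: conv of_nat_power of_nat_numeral)
  moreover have "\<not> int (2 ^ Suc m) dvd int (q\<^sup>2 - 1)" using m_props(3) unfolding of_nat_dvd_iff .
  then have "\<not> 2 ^ Suc m dvd (int q)\<^sup>2 - 1" unfolding conv of_nat_power of_nat_numeral .
  moreover have "int (q mod 4) = int 3" by (simp only: q_mod_4)
  then have "int q mod 4 = 3" by (simp add: of_nat_mod)
  ultimately show False using not_two_power_dvd_power_minus_one[of "int q" m s r] m_props(1) assms by simp
qed

section \<open>Irreducibility of the individual factors\<close>

lemma irreducible_reciprocal_quadratic:
  assumes c: "\<phi> c = a + a'" and inv: "a * a' = 1" and a: "a ^ q \<noteq> a"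
  shows "irreducible [:1, - c, 1:]"
proof (rule irreducible_if_frobenius_orbits_long[OF hom frob frobenius_fixed])
  fix z s assume root: "poly (map_poly \<phi> [:1, - c, 1:]) z = 0" and s: "0 < s" "s < degree [:1, - c, 1:]"
  have "(z - a) * (z - a') = z * z - (a + a') * z + a * a'" by (simp add: algebra_simps)
  also have "\<dots> = 0" using root by (simp add: map_poly_pCons hom_uminus c inv algebra_simps)
  finally have "z = a \<or> z = a'" by simp
  \<comment> \<open>The roots are \<open>a\<close> and its inverse; if Frobenius fixed one it would
    fix the other. In degree 2 only \<open>s = 1\<close> has to be excluded.\<close>
  moreover have "a' ^ q \<noteq> a'"
  proof
    assume "a' ^ q = a'"
    then have "a ^ q * a' = 1" using inv by (metis power_mult_distrib power_one)
    then show False using a inv by (metis mult.commute mult.left_commute mult_1_right)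
  qed
  ultimately show "z ^ (q ^ s) \<noteq> z" using a s by (cases "s = 1") auto
qed simp

text \<open>With \<open>w = z ^ (2 ^ r)\<close> the equation splits as
  \<open>(w + a) * (w - a') = 0\<close>. Either value of \<open>w\<close> has
  \<open>2 ^ (m - 1) * d\<close>-th power -1, so the order of \<open>z\<close> is divisible by
  \<open>2 ^ (m + r)\<close>, which forces a Frobenius orbit as long as the degree.\<close>

lemma irreducible_quadratic_in_two_power:
  assumes c: "\<phi> c = a - a'" and inv: "a * a' = 1" and a: "a ^ (2 ^ (m - 1) * d) = - 1"
  shows "irreducible (monom 1 (2 ^ (r + 1)) + monom c (2 ^ r) - 1)"
proof -
  let ?f = "monom 1 (2 ^ (r + 1)) + monom c (2 ^ r) - 1"
  have "degree (monom c (2 ^ r) - 1) \<le> 2 ^ r"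
    by (rule degree_diff_le) (auto simp: degree_monom_le)
  also have "\<dots> < 2 ^ (r + 1)" by simp
  finally have deg: "degree ?f = 2 ^ Suc r"
    by (simp add: degree_add_eq_left degree_monom_eq flip: add_diff_eq)
  show ?thesis
  proof (rule irreducible_if_frobenius_orbits_long[OF hom frob frobenius_fixed])
    fix z s assume root: "poly (map_poly \<phi> ?f) z = 0" and s: "0 < s" "s < degree ?f"
    define w where "w = z ^ (2 ^ r)"
    have "w * w + (a - a') * w - 1 = 0"
      using root by (simp add: P.hom_add P.hom_minus poly_monom c w_def mult_2 power_add)
    then have "(w + a) * (w - a') = 0" using inv by (simp add: algebra_simps)
    then have "w = - a \<or> w = a'" by (auto simp: eq_neg_iff_add_eq_0)
    \<comment> \<open>The even exponent removes the sign of \<open>- a\<close>.\<close>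
    moreover have "even (2 ^ (m - 1) * d)" using m_props(1) by simp
    then have "(- a) ^ (2 ^ (m - 1) * d) = - 1" using a by simp
    moreover have "a' ^ (2 ^ (m - 1) * d) = - 1" by (rule inverse_power_eq_minus_one[OF inv a])
    ultimately have "w ^ (2 ^ (m - 1) * d) = - 1" by blast
    then have "z ^ (2 ^ (m - 1 + r) * d) = - 1"
      by (simp add: w_def power_add mult_ac flip: power_mult)
    moreover have "\<not> 2 ^ Suc (m - 1 + r) dvd q ^ s - 1"
      using s unfolding deg by (rule not_two_power_dvd)
    ultimately show "z ^ (q ^ s) \<noteq> z" by (rule frobenius_power_neq)
  qed (simp only: deg, simp)
qed

lemma \<delta>_conj: "\<phi> (\<delta> j) = \<gamma> ^ j + (\<gamma> ^ q) ^ j"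
  by (simp add: \<delta> power_mult)

lemma \<theta>_conj:
  assumes "i \<ge> 1" "k \<le> m"
  shows "\<phi> (\<theta> i j k) = \<beta> k ^ (2 * i - 1) * \<gamma> ^ j + (\<beta> k ^ q) ^ (2 * i - 1) * (\<gamma> ^ q) ^ j"
  using assms by (simp add: \<theta> power_mult)

lemma \<beta>\<gamma>_power:
  assumes "1 \<le> k" "k \<le> m" "odd e"
  shows "(\<beta> k ^ e * \<gamma> ^ j) ^ (2 ^ (k - 1) * d) = - 1"
proof -
  have "(\<beta> k ^ e * \<gamma> ^ j) ^ (2 ^ (k - 1) * d) = (\<beta> k ^ (2 ^ (k - 1))) ^ (e * d) * (\<gamma> ^ d) ^ (j * 2 ^ (k - 1))"
    by (simp only: power_mult_distrib power_mult[symmetric] mult_ac)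
  also have "\<dots> = - 1"
    using \<beta>_half[OF assms(1,2)] \<gamma> odd_d assms(3) by (simp add: primitive_root_of_unity_def)
  finally show ?thesis .
qed

lemma irreducible_\<delta>:
  assumes j: "j \<in> {1..(d - 1) div 2}"
  shows "irreducible [:1, \<delta> j, 1:]" "irreducible [:1, - \<delta> j, 1:]"
proof -
  have inv: "\<gamma> ^ j * (\<gamma> ^ q) ^ j = 1"
    by (simp only: \<gamma>_inverse power_one flip: power_mult_distrib)
  have neq: "(\<gamma> ^ j) ^ q \<noteq> \<gamma> ^ j"
  proof
    assume "(\<gamma> ^ j) ^ q = \<gamma> ^ j"
    \<comment> \<open>The conjugate is also the inverse, so a fixed \<open>\<gamma> ^ j\<close>
      would square to 1, although \<open>0 < 2 * j < d\<close>.\<close>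
    then have "\<gamma> ^ j * \<gamma> ^ j = 1" using inv by (simp add: mult.commute flip: power_mult)
    then have "\<gamma> ^ (2 * j) = 1" by (simp add: mult_2 power_add)
    moreover have "0 < 2 * j" "2 * j < d" using j odd_d by (auto elim!: oddE)
    ultimately show False using \<gamma> by (auto simp: primitive_root_of_unity_def)
  qed
  have "odd q" using q_mod_4 by presburger
  \<comment> \<open>The plus sign belongs to the root \<open>- (\<gamma> ^ j)\<close>; as
    \<open>q\<close> is odd, Frobenius commutes with negation.\<close>
  have "irreducible [:1, - (- \<delta> j), 1:]"
    by (rule irreducible_reciprocal_quadratic[where a = "- (\<gamma> ^ j)" and a' = "- ((\<gamma> ^ q) ^ j)"])
      (use inv neq \<open>odd q\<close> in \<open>simp_all add: \<delta>_conj hom_uminus\<close>)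
  then show "irreducible [:1, \<delta> j, 1:]" by simp
  show "irreducible [:1, - \<delta> j, 1:]"
    by (rule irreducible_reciprocal_quadratic[OF \<delta>_conj inv neq])
qed

lemma irreducible_\<theta>:
  assumes k: "2 \<le> k" "k \<le> m - 1" and i: "i \<ge> 1"
  shows "irreducible [:1, - \<theta> i j k, 1:]"
proof (rule irreducible_reciprocal_quadratic)
  have k': "1 \<le> k" "k \<le> m" using k by auto
  show "\<phi> (\<theta> i j k) = \<beta> k ^ (2 * i - 1) * \<gamma> ^ j + (\<beta> k ^ q) ^ (2 * i - 1) * (\<gamma> ^ q) ^ j"
    using i k'(2) by (rule \<theta>_conj)
  show "(\<beta> k ^ (2 * i - 1) * \<gamma> ^ j) * ((\<beta> k ^ q) ^ (2 * i - 1) * (\<gamma> ^ q) ^ j) = 1"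
    by (rule inverse_pair[OF \<beta>_inverse[OF k'(1) k(2)] \<gamma>_inverse])
  have "(\<beta> k ^ (2 * i - 1) * \<gamma> ^ j) ^ (2 ^ (k - 1) * d) = - 1"
    using k' i by (intro \<beta>\<gamma>_power) auto
  \<comment> \<open>Here \<open>k \<ge> 2\<close> matters: 4 divides \<open>2 ^ k\<close> but not
    \<open>q - 1\<close>.\<close>
  moreover have "\<not> 2 ^ Suc (k - 1) dvd q ^ 1 - 1"
  proof
    assume "2 ^ Suc (k - 1) dvd q ^ 1 - 1"
    moreover have "(2::nat) ^ 2 dvd 2 ^ Suc (k - 1)" using k by (intro le_imp_power_dvd) simp
    ultimately have "2 ^ 2 dvd q - 1" by (metis dvd_trans power_one_right)
    then show False using q_mod_4 by simp presburger
  qed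
  ultimately show "(\<beta> k ^ (2 * i - 1) * \<gamma> ^ j) ^ q \<noteq> \<beta> k ^ (2 * i - 1) * \<gamma> ^ j"
    using frobenius_power_neq[where s = 1] by simp
qed

text \<open>The odd exponent pulls the sign out, writing \<theta> as \<open>a - a'\<close> with
  \<open>a * a' = 1\<close>.\<close>

lemma \<theta>_top_conj:
  assumes "i \<ge> 1"
  shows "\<phi> (\<theta> i j m) = \<beta> m ^ (2 * i - 1) * \<gamma> ^ j - (- (\<beta> m ^ q)) ^ (2 * i - 1) * (\<gamma> ^ q) ^ j"
proof -
  have "odd (2 * i - 1)" using assms by auto
  then show ?thesis using \<theta>_conj[OF assms order_refl] by simp
qed

lemma irreducible_\<theta>_top:
  assumes i: "i \<ge> 1"
  shows "irreducible (monom 1 (2 ^ (r + 1)) + monom (\<theta> i j m) (2 ^ r) - 1)"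
    "irreducible (monom 1 (2 ^ (r + 1)) - monom (\<theta> i j m) (2 ^ r) - 1)"
proof -
  let ?a = "\<beta> m ^ (2 * i - 1) * \<gamma> ^ j" and ?a' = "(- (\<beta> m ^ q)) ^ (2 * i - 1) * (\<gamma> ^ q) ^ j"
  note conj = \<theta>_top_conj[OF i, of j]
  have inv: "?a * ?a' = 1" by (rule inverse_pair[OF \<beta>_top_inverse \<gamma>_inverse])
  have a: "?a ^ (2 ^ (m - 1) * d) = - 1" using m_props(1) i by (intro \<beta>\<gamma>_power) auto
  show "irreducible (monom 1 (2 ^ (r + 1)) + monom (\<theta> i j m) (2 ^ r) - 1)"
    by (rule irreducible_quadratic_in_two_power[OF conj inv a])
  have a': "?a' ^ (2 ^ (m - 1) * d) = - 1" by (rule inverse_power_eq_minus_one[OF inv a])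
  \<comment> \<open>Exchanging the roles of \<open>a\<close> and \<open>a'\<close> negates \<theta>
    and gives the other factor of the pair.\<close>
  have "\<phi> (- \<theta> i j m) = ?a' - ?a" "?a' * ?a = 1"
    using conj inv by (simp_all only: hom_uminus minus_diff_eq mult.commute)
  then have "irreducible (monom 1 (2 ^ (r + 1)) + monom (- \<theta> i j m) (2 ^ r) - 1)"
    using a' by (rule irreducible_quadratic_in_two_power)
  then show "irreducible (monom 1 (2 ^ (r + 1)) - monom (\<theta> i j m) (2 ^ r) - 1)"
    by (simp flip: minus_monom)
qed

end

section \<open>Number of factors\<close>

lemma size_sum_multisets:
  fixes F :: "'b \<Rightarrow> 'c multiset"
  shows "size (\<Sum>x\<in>A. F x) = (\<Sum>x\<in>A. size (F x))"
  by (induction A rule: infinite_finite_induct) auto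

lemma size_low_factors:
  assumes "odd d" "n \<ge> 1"
  shows "size (low_factors \<delta> \<theta> d n) = 2 ^ (n - 1) * d + 1"
proof -
  \<comment> \<open>The two linear factors and the \<delta> pairs number \<open>d + 1\<close>; their
    \<open>d\<close> completes the geometric sum, and the 1 remains.\<close>
  have "(\<Sum>k = 2..n. 2 ^ (k - 2) * d) + d = 2 ^ (n - 1) * d"
    using assms(2)
  proof (induction n rule: nat_induct_at_least)
    case (Suc n)
    then have "(\<Sum>k = 2..Suc n. 2 ^ (k - 2) * d) = (\<Sum>k = 2..n. 2 ^ (k - 2) * d) + 2 ^ (n - 1) * d"
      by (simp add: sum.cl_ivl_Suc)
    moreover have "2 ^ n = 2 ^ (n - 1) + (2::nat) ^ (n - 1)" using Suc.hyps by (cases n) auto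
    ultimately show ?case using Suc.IH by (simp add: algebra_simps)
  qed simp
  moreover have "2 + 2 * ((d - 1) div 2) = d + 1" using assms(1) by (auto elim!: oddE)
  ultimately show ?thesis
    by (simp add: low_factors_def size_sum_multisets mult.commute)
qed

lemma size_high_factors:
  assumes "odd d" "m \<ge> 3"
  shows "size (high_factors \<delta> \<theta> d m n) = 2 ^ (m - 2) * d * (n - m + 2) + 1"
proof -
  \<comment> \<open>Removes the truncated subtractions \<open>m - 1\<close>, \<open>m - 2\<close>
    and \<open>m - 3\<close>.\<close>
  obtain t where t: "m = t + 3" using assms(2) by (metis le_add_diff_inverse2)
  have "m - 1 \<ge> 1" using assms(2) by simp
  then have "size (low_factors \<delta> \<theta> d (m - 1)) = 2 ^ (m - 1 - 1) * d + 1"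
    by (rule size_low_factors[OF assms(1)])
  then show ?thesis
    by (simp add: high_factors_def size_sum_multisets t algebra_simps)
qed

section \<open>Product formulas\<close>

context frobenius_setting
begin

lemma map_reciprocal_quadratic:
  assumes "\<phi> c = a + a'" "a * a' = 1"
  shows "map_poly \<phi> [:1, - c, 1:] = ([:0, 1:] - [:a:]) * ([:0, 1:] - [:a':])"
  using assms by (simp add: map_poly_pCons hom_uminus algebra_simps)

lemma map_poly_monom_one: "map_poly \<phi> (monom 1 n) = [:0, 1:] ^ n"
  by (subst map_poly_monom) (simp_all add: monom_altdef)

text \<open>Checked after the injective map to \<open>'b\<close>. The linear and \<delta> factors
  give \<open>x ^ (2 * d) - 1\<close>, the block at level \<open>k\<close> gives
  \<open>x ^ (2 ^ (k - 1) * d) + 1\<close>, and the product telescopes.\<close>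

lemma low_product:
  assumes n: "1 \<le> n" "n \<le> m - 1"
  shows "monom 1 (2 ^ n * d) - 1 =
            [:-1, 1:] * [:1, 1:]
            * (\<Prod>j = 1..(d - 1) div 2. [:1, \<delta> j, 1:] * [:1, - \<delta> j, 1:])
            * (\<Prod>k = 2..n. \<Prod>i = 1..2 ^ (k - 2). \<Prod>j = 0..<d. [:1, - \<theta> i j k, 1:])"
    (is "?L = [:-1, 1:] * [:1, 1:] * ?D * ?T")
proof -
  let ?x = "[:0, 1:] :: 'b poly"
  let ?G = "\<lambda>p. (\<Prod>j = 1..(d - 1) div 2. (p - [:\<gamma> ^ j:]) * (p - [:(\<gamma> ^ q) ^ j:]))"
  note half = power_odd_minus_one_eq_prod[OF \<gamma> \<gamma>_inverse odd_d]
  \<comment> \<open>The plus quadratic is the minus quadratic evaluated at \<open>- x\<close>, so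
    the factorization of \<open>p ^ d - 1\<close> can be used at \<open>p = - x\<close> and at
    \<open>p = x\<close>; since \<open>d\<close> is odd, the former yields \<open>x ^ d + 1\<close>
    up to sign.\<close>
  have pair: "map_poly \<phi> ([:1, \<delta> j, 1:] * [:1, - \<delta> j, 1:])
      = ((- ?x - [:\<gamma> ^ j:]) * (- ?x - [:(\<gamma> ^ q) ^ j:])) * ((?x - [:\<gamma> ^ j:]) * (?x - [:(\<gamma> ^ q) ^ j:]))" for j
  proof -
    have inv: "\<gamma> ^ j * (\<gamma> ^ q) ^ j = 1"
      by (simp only: \<gamma>_inverse power_one flip: power_mult_distrib)
    have "map_poly \<phi> [:1, - (- \<delta> j), 1:] = (?x - [:- (\<gamma> ^ j):]) * (?x - [:- ((\<gamma> ^ q) ^ j):])"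
      by (rule map_reciprocal_quadratic) (use inv in \<open>simp_all add: \<delta>_conj hom_uminus\<close>)
    moreover have "\<dots> = (- ?x - [:\<gamma> ^ j:]) * (- ?x - [:(\<gamma> ^ q) ^ j:])" by simp
    ultimately show ?thesis
      by (simp only: P.hom_mult map_reciprocal_quadratic[OF \<delta>_conj inv] minus_minus)
  qed
  have "map_poly \<phi> ([:-1, 1:] * [:1, 1:] * ?D) = (?x - 1) * (?x + 1) * (?G (- ?x) * ?G ?x)"
  proof -
    have "?x - 1 = [:-1, 1:]" "?x + 1 = [:1, 1:]"
      by (simp_all only: one_pCons diff_pCons add_pCons diff_0 diff_zero add_0 add_0_right)
    then have "map_poly \<phi> [:-1, 1:] = ?x - 1" "map_poly \<phi> [:1, 1:] = ?x + 1"
      by (simp_all add: map_poly_pCons hom_uminus)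
    moreover have "map_poly \<phi> ?D = ?G (- ?x) * ?G ?x"
      unfolding P.hom_prod pair by (simp only: prod.distrib)
    ultimately show ?thesis by (simp only: P.hom_mult[of _ ?D] P.hom_mult[of "[:-1, 1:]"])
  qed
  also have "\<dots> = - (((- ?x - 1) * ?G (- ?x)) * ((?x - 1) * ?G ?x))"
  proof -
    have "(y - 1) * (y + 1) * (A * B) = - (((- y - 1) * A) * ((y - 1) * B))" for y A B :: "'b poly"
      by (simp add: algebra_simps)
    then show ?thesis .
  qed
  also have "\<dots> = - ((- ?x) ^ d - 1) * (?x ^ d - 1)"
    by (simp only: half mult_minus_left)
  also have "\<dots> = (?x ^ d) ^ (2 ^ 1) - 1"
  proof -
    have "- (- y - 1) * (y - 1) = y ^ (2 ^ 1) - 1" for y :: "'b poly"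
      by (simp add: algebra_simps power2_eq_square)
    then show ?thesis by (simp only: power_minus_odd[OF odd_d])
  qed
  finally have D: "map_poly \<phi> ([:-1, 1:] * [:1, 1:] * ?D) = (?x ^ d) ^ (2 ^ 1) - 1" .
  have block: "map_poly \<phi> (\<Prod>i = 1..2 ^ (k - 2). \<Prod>j = 0..<d. [:1, - \<theta> i j k, 1:])
      = (?x ^ d) ^ (2 ^ (k - 1)) + 1" if k: "k \<in> {2..n}" for k
  proof -
    have k': "1 \<le> k" "k \<le> m - 1" "k \<le> m" "Suc (k - 2) = k - 1" using k n by auto
    have "map_poly \<phi> (\<Prod>i = 1..2 ^ (k - 2). \<Prod>j = 0..<d. [:1, - \<theta> i j k, 1:])
       = (\<Prod>i = 1..2 ^ (k - 2). \<Prod>j = 0..<d. (?x - [:\<beta> k ^ (2 * i - 1) * \<gamma> ^ j:])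
            * (?x - [:(\<beta> k ^ q) ^ (2 * i - 1) * (\<gamma> ^ q) ^ j:]))"
      unfolding P.hom_prod
      using k' by (intro prod.cong refl map_reciprocal_quadratic \<theta>_conj inverse_pair \<gamma>_inverse \<beta>_inverse) auto
    also have "\<dots> = ?x ^ (2 ^ Suc (k - 2) * d) + 1"
      using \<beta>_half[OF k'(1,3)] k'
      by (intro prod_inverse_pairs \<gamma> \<gamma>_inverse odd_d \<beta>_inverse) simp_all
    finally show ?thesis by (simp only: k' mult.commute flip: power_mult)
  qed
  have "map_poly \<phi> ?T = (\<Prod>k = 2..n. (?x ^ d) ^ (2 ^ (k - 1)) + 1)"
    unfolding P.hom_prod[of _ "{2..n}"] by (intro prod.cong refl block)
  \<comment> \<open>Reindexing by \<open>k = r + 2\<close> puts the product in telescoping form with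
    start 1 and \<open>n - 1\<close> factors.\<close>
  also have "\<dots> = (\<Prod>r<n - 1. (?x ^ d) ^ (2 ^ (1 + r)) + 1)"
  proof -
    have "1 + (k - 2) = k - 1" if "k \<in> {2..n}" for k using that by auto
    then show ?thesis
      by (intro prod.reindex_bij_witness[where i = "\<lambda>r. r + 2" and j = "\<lambda>k. k - 2"])
        (auto simp del: One_nat_def power_Suc plus_1_eq_Suc)
  qed
  finally have "map_poly \<phi> ([:-1, 1:] * [:1, 1:] * ?D * ?T) = (?x ^ d) ^ (2 ^ (1 + (n - 1))) - 1"
    by (simp only: P.hom_mult[of _ ?T] D power_two_power_telescope)
  also have "1 + (n - 1) = n" using n by simp
  also have "(?x ^ d) ^ (2 ^ n) - 1 = map_poly \<phi> ?L"
    by (simp only: P.hom_minus P.hom_one map_poly_monom_one mult.commute flip: power_mult)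
  finally show ?thesis by (rule P.injectivity[THEN sym])
qed

lemma high_product:
  assumes n: "m \<le> n"
  shows "monom 1 (2 ^ n * d) - 1 =
            (monom 1 (2 ^ (m - 1) * d) - 1)
            * (\<Prod>r = 0..n - m. \<Prod>i = 1..2 ^ (m - 3). \<Prod>j = 0..<d.
                 (monom 1 (2 ^ (r + 1)) + monom (\<theta> i j m) (2 ^ r) - 1)
                 * (monom 1 (2 ^ (r + 1)) - monom (\<theta> i j m) (2 ^ r) - 1))"
    (is "?L = ?M * (\<Prod>r = 0..n - m. ?T r)")
proof -
  let ?x = "[:0, 1:] :: 'b poly"
  have m: "3 \<le> m" "Suc (m - 3) = m - 2" "2 * 2 ^ (m - 2) = (2::nat) ^ (m - 1)"
    using m_props(1) by (auto simp: Suc_diff_Suc numeral_eq_Suc simp flip: power_Suc)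
  let ?b = "(\<beta> m)\<^sup>2" and ?b' = "(- (\<beta> m ^ q))\<^sup>2"
  have b1: "?b * ?b' = 1" and g: "\<gamma>\<^sup>2 * (\<gamma> ^ q)\<^sup>2 = 1"
    by (simp_all only: \<beta>_top_inverse \<gamma>_inverse power_one flip: power_mult_distrib)
  \<comment> \<open>Squaring lowers the order of \<open>\<beta> m\<close> to
    \<open>2 ^ (m - 1)\<close>, which fits the index range of length
    \<open>2 ^ (m - 3)\<close>.\<close>
  have b2: "?b ^ (2 ^ Suc (m - 3)) = - 1"
    using \<beta>_half[of m] m(1) by (simp only: m(2,3) flip: power_mult)
  have block: "map_poly \<phi> (?T r) = (?x ^ d) ^ (2 ^ (m - 1 + r)) + 1" for r
  proof -
    let ?p = "?x ^ (2 ^ r)"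
    have "map_poly \<phi> ((monom 1 (2 ^ (r + 1)) + monom (\<theta> i j m) (2 ^ r) - 1)
         * (monom 1 (2 ^ (r + 1)) - monom (\<theta> i j m) (2 ^ r) - 1))
       = (?p\<^sup>2 - [:?b ^ (2 * i - 1) * (\<gamma>\<^sup>2) ^ j:]) * (?p\<^sup>2 - [:?b' ^ (2 * i - 1) * ((\<gamma> ^ q)\<^sup>2) ^ j:])"
      if i: "i \<ge> 1" for i j
    proof -
      let ?a = "\<beta> m ^ (2 * i - 1) * \<gamma> ^ j" and ?a' = "(- (\<beta> m ^ q)) ^ (2 * i - 1) * (\<gamma> ^ q) ^ j"
      have "[:u:] * [:v:] = [:u * v:]" for u v :: 'b by (simp add: mult.commute)
      \<comment> \<open>Writing the constant 1 as this product makes the pair factor as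
        \<open>(y + u) * (y - v)\<close> times \<open>(y - u) * (y + v)\<close>, an identity in free
        \<open>y\<close>, \<open>u\<close>, \<open>v\<close>.\<close>
      then have inv: "[:?a:] * [:?a':] = 1"
        by (simp only: inverse_pair[OF \<beta>_top_inverse \<gamma>_inverse] one_pCons)
      have mon: "map_poly \<phi> (monom (\<theta> i j m) (2 ^ r)) = ([:?a:] - [:?a':]) * ?p"
        using \<theta>_top_conj[OF i, of j] by (subst map_poly_monom) (simp_all add: monom_altdef)
      have top: "map_poly \<phi> (monom 1 (2 ^ (r + 1))) = ?p * ?p"
        by (simp only: map_poly_monom_one power_add power_one_right power_mult power2_eq_square)
      have "map_poly \<phi> ((monom 1 (2 ^ (r + 1)) + monom (\<theta> i j m) (2 ^ r) - 1)
         * (monom 1 (2 ^ (r + 1)) - monom (\<theta> i j m) (2 ^ r) - 1))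
         = (?p * ?p + ([:?a:] - [:?a':]) * ?p - [:?a:] * [:?a':])
           * (?p * ?p - ([:?a:] - [:?a':]) * ?p - [:?a:] * [:?a':])"
        by (simp only: P.hom_mult P.hom_add P.hom_minus P.hom_one mon top inv)
      also have "\<dots> = (?p\<^sup>2 - [:?a:]\<^sup>2) * (?p\<^sup>2 - [:?a':]\<^sup>2)"
      proof -
        have "(y * y + (u - v) * y - u * v) * (y * y - (u - v) * y - u * v) = (y\<^sup>2 - u\<^sup>2) * (y\<^sup>2 - v\<^sup>2)"
          for y u v :: "'b poly"
          by (simp add: algebra_simps power2_eq_square)
        then show ?thesis .
      qed
      also have "[:?a:]\<^sup>2 = [:?b ^ (2 * i - 1) * (\<gamma>\<^sup>2) ^ j:]"
        by (simp only: poly_const_pow power_mult_distrib mult_ac flip: power_mult)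
      also have "[:?a':]\<^sup>2 = [:?b' ^ (2 * i - 1) * ((\<gamma> ^ q)\<^sup>2) ^ j:]"
        by (simp only: poly_const_pow power_mult_distrib mult_ac flip: power_mult)
      finally show ?thesis .
    qed
    then have "map_poly \<phi> (?T r) = (\<Prod>i = 1..2 ^ (m - 3). \<Prod>j = 0..<d.
        (?p\<^sup>2 - [:?b ^ (2 * i - 1) * (\<gamma>\<^sup>2) ^ j:]) * (?p\<^sup>2 - [:?b' ^ (2 * i - 1) * ((\<gamma> ^ q)\<^sup>2) ^ j:]))"
      unfolding P.hom_prod by (intro prod.cong refl) auto
    also have "\<dots> = (?p\<^sup>2) ^ (2 ^ Suc (m - 3) * d) + 1"
      by (rule prod_inverse_pairs[OF primitive_root_of_unity_square[OF \<gamma> odd_d] g odd_d b1 b2])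
    also have "(?p\<^sup>2) ^ (2 ^ Suc (m - 3) * d) = ?x ^ (d * ((2 * 2 ^ (m - 2)) * 2 ^ r))"
      by (simp only: m(2) mult_ac flip: power_mult)
    also have "\<dots> = (?x ^ d) ^ (2 ^ (m - 1 + r))"
      by (simp only: m(3) power_mult power_add)
    finally show ?thesis .
  qed
  \<comment> \<open>There are \<open>n - m + 1\<close> blocks, so telescoping from exponent
    \<open>m - 1\<close> ends at \<open>n\<close>.\<close>
  have "{0..n - m} = {..<Suc (n - m)}" by auto
  then have "map_poly \<phi> (\<Prod>r = 0..n - m. ?T r) = (\<Prod>r<Suc (n - m). (?x ^ d) ^ (2 ^ (m - 1 + r)) + 1)"
    by (simp only: P.hom_prod[of _ "{..<Suc (n - m)}"] block)
  moreover have "map_poly \<phi> ?M = (?x ^ d) ^ (2 ^ (m - 1)) - 1"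
    by (simp only: P.hom_minus P.hom_one map_poly_monom_one mult.commute flip: power_mult)
  ultimately have "map_poly \<phi> (?M * (\<Prod>r = 0..n - m. ?T r)) = (?x ^ d) ^ (2 ^ (m - 1 + Suc (n - m))) - 1"
    by (simp only: P.hom_mult[of ?M] power_two_power_telescope)
  also have "m - 1 + Suc (n - m) = n" using n m(1) by simp
  also have "(?x ^ d) ^ (2 ^ n) - 1 = map_poly \<phi> ?L"
    by (simp only: P.hom_minus P.hom_one map_poly_monom_one mult.commute flip: power_mult)
  finally show ?thesis by (rule P.injectivity[THEN sym])
qed

lemma irreducible_low_factors:
  assumes "n \<le> m - 1" "f \<in># low_factors \<delta> \<theta> d n"
  shows "irreducible f"
proof -
  \<comment> \<open>In degree 1 no \<open>s\<close> satisfies \<open>0 < s < 1\<close>, so the orbit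
    condition is vacuous.\<close>
  have linear: "irreducible [:c, 1:]" for c :: 'k
    by (rule irreducible_if_frobenius_orbits_long[OF hom frob frobenius_fixed]) auto
  show ?thesis
    using assms irreducible_\<delta> irreducible_\<theta> linear
    by (auto simp: low_factors_def set_mset_sum)
qed

lemma irreducible_high_factors:
  assumes "f \<in># high_factors \<delta> \<theta> d m n"
  shows "irreducible f"
  using assms irreducible_low_factors[of "m - 1" f] irreducible_\<theta>_top
  by (auto simp: high_factors_def set_mset_sum)

end

section \<open>Descent of the coefficients and assembly\<close>

theorem theorem4p3:
  fixes \<iota> :: "'k::{field,finite} \<Rightarrow> 'l::{field,finite}"
    and q d m :: nat
    and \<gamma> :: 'l
    and \<beta> :: "nat \<Rightarrow> 'l"
  assumes "primepow q"
    and "CARD('k) = q"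
    and "CARD('l) = q ^ 2"
    and "field_hom \<iota>"
    and "[q = 3] (mod 4)"
    and "odd d"
    and "[int q = - 1] (mod int d)"
    and "m = multiplicity 2 (q ^ 2 - 1)"
    and "primitive_root_of_unity d \<gamma>"
    and "\<forall>k\<le>m. primitive_root_of_unity (2 ^ k) (\<beta> k)"
  shows "3 \<le> m \<and>
    (\<exists>(\<delta> :: nat \<Rightarrow> 'k) (\<theta> :: nat \<Rightarrow> nat \<Rightarrow> nat \<Rightarrow> 'k).
      (\<forall>j. \<iota> (\<delta> j) = \<gamma> ^ j + \<gamma> ^ (q * j)) \<and>
      (\<forall>i\<ge>1. \<forall>j. \<forall>k\<le>m. \<iota> (\<theta> i j k) =
          \<beta> k ^ (2 * i - 1) * \<gamma> ^ j + \<beta> k ^ (q * (2 * i - 1)) * \<gamma> ^ (q * j)) \<and>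
      (\<forall>n. 2 \<le> n \<and> n \<le> m - 1 \<longrightarrow>
          monom 1 (2 ^ n * d) - 1 =
            [:-1, 1:] * [:1, 1:]
            * (\<Prod>j = 1..(d - 1) div 2. [:1, \<delta> j, 1:] * [:1, - \<delta> j, 1:])
            * (\<Prod>k = 2..n. \<Prod>i = 1..2 ^ (k - 2). \<Prod>j = 0..<d. [:1, - \<theta> i j k, 1:]) \<and>
          monom 1 (2 ^ n * d) - 1 = prod_mset (low_factors \<delta> \<theta> d n) \<and>
          (\<forall>f \<in># low_factors \<delta> \<theta> d n. irreducible f) \<and>
          size (low_factors \<delta> \<theta> d n) = 2 ^ (n - 1) * d + 1) \<and>
      (\<forall>n\<ge>m.
          monom 1 (2 ^ n * d) - 1 =
            (monom 1 (2 ^ (m - 1) * d) - 1)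
            * (\<Prod>r = 0..n - m. \<Prod>i = 1..2 ^ (m - 3). \<Prod>j = 0..<d.
                 (monom 1 (2 ^ (r + 1)) + monom (\<theta> i j m) (2 ^ r) - 1)
                 * (monom 1 (2 ^ (r + 1)) - monom (\<theta> i j m) (2 ^ r) - 1)) \<and>
          monom 1 (2 ^ n * d) - 1 = prod_mset (high_factors \<delta> \<theta> d m n) \<and>
          (\<forall>f \<in># high_factors \<delta> \<theta> d m n. irreducible f) \<and>
          size (high_factors \<delta> \<theta> d m n) = 2 ^ (m - 2) * d * (n - m + 2) + 1))"
proof -
  interpret \<iota>: field_hom \<iota> by fact
  obtain p e where p: "prime p" "q = p ^ e"
    using \<open>primepow q\<close> by (auto simp: primepow_def)
  have char: "CHAR('l) = p"
    by (rule CHAR_of_primepow_card[where e = "e * 2"])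
      (use p \<open>CARD('l) = q ^ 2\<close> in \<open>simp_all add: power_mult\<close>)
  have frob_l: "(x + y) ^ q = x ^ q + y ^ q" for x y :: 'l
    using p char by (intro freshmans_dream') auto
  have frob: "(x + y) ^ q = x ^ q + y ^ q" for x y :: "'l alg_closure"
    using p char by (intro freshmans_dream') auto
  \<comment> \<open>In a field with \<open>q\<^sup>2\<close> elements Frobenius swaps
    \<open>a\<close> and \<open>a ^ q\<close>, so their sum is fixed and comes from the small
    field.\<close>
  have trace: "\<exists>c. \<iota> c = a + a ^ q" for a
  proof -
    have "(a ^ q) ^ q = a"
      using finite_field_power_card[of a] \<open>CARD('l) = q ^ 2\<close>
      by (simp add: power2_eq_square power_mult)
    then have "(a + a ^ q) ^ q = a + a ^ q" by (simp add: frob_l add.commute)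
    then have "a + a ^ q \<in> range \<iota>"
      using range_field_hom_eq_frobenius_fixed[OF \<open>field_hom \<iota>\<close>] \<open>CARD('k) = q\<close> by simp
    then show ?thesis by (metis rangeE)
  qed
  \<comment> \<open>Both coefficient families are chosen as preimages under \<iota> of traces, of
    \<open>\<gamma> ^ j\<close> and of
    \<open>\<beta> k ^ (2 * i - 1) * \<gamma> ^ j\<close>.\<close>
  define \<delta> where "\<delta> j = (SOME c. \<iota> c = \<gamma> ^ j + (\<gamma> ^ j) ^ q)" for j
  define \<theta> where "\<theta> i j k = (SOME c. \<iota> c = \<beta> k ^ (2 * i - 1) * \<gamma> ^ j + (\<beta> k ^ (2 * i - 1) * \<gamma> ^ j) ^ q)"
    for i j k :: nat
  have "\<iota> (\<delta> j) = \<gamma> ^ j + (\<gamma> ^ j) ^ q" for j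
    unfolding \<delta>_def by (rule someI_ex) (rule trace)
  then have \<delta>_eq: "\<iota> (\<delta> j) = \<gamma> ^ j + \<gamma> ^ (q * j)" for j
    by (simp only: mult.commute flip: power_mult)
  have "\<iota> (\<theta> i j k) = \<beta> k ^ (2 * i - 1) * \<gamma> ^ j + (\<beta> k ^ (2 * i - 1) * \<gamma> ^ j) ^ q" for i j k
    unfolding \<theta>_def by (rule someI_ex) (rule trace)
  then have \<theta>_eq: "\<iota> (\<theta> i j k) = \<beta> k ^ (2 * i - 1) * \<gamma> ^ j + \<beta> k ^ (q * (2 * i - 1)) * \<gamma> ^ (q * j)" for i j k
    by (simp only: power_mult_distrib mult.commute flip: power_mult)
  have prim: "primitive_root_of_unity n (to_ac x)" if "primitive_root_of_unity n x" for n and x :: 'l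
    using that by (simp add: primitive_root_of_unity_def flip: to_ac_power)
  interpret frobenius_setting "\<lambda>c. to_ac (\<iota> c)" q d m "to_ac \<gamma>" "\<lambda>k. to_ac (\<beta> k)" \<delta> \<theta>
  proof
    show "q mod 4 = 3" using \<open>[q = 3] (mod 4)\<close> by (simp add: cong_def)
    have "int d dvd int q - - 1" using \<open>[int q = - 1] (mod int d)\<close> by (simp only: cong_iff_dvd_diff)
    then have "int d dvd int (q + 1)" by (simp add: add.commute)
    then show "d dvd q + 1" by (simp only: of_nat_dvd_iff)
    show "to_ac (\<iota> (\<delta> j)) = to_ac \<gamma> ^ j + to_ac \<gamma> ^ (q * j)" for j
      by (simp add: \<delta>_eq)
    show "to_ac (\<iota> (\<theta> i j k)) = to_ac (\<beta> k) ^ (2 * i - 1) * to_ac \<gamma> ^ j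
        + to_ac (\<beta> k) ^ (q * (2 * i - 1)) * to_ac \<gamma> ^ (q * j)" for i j k
      by (simp add: \<theta>_eq)
  qed (use assms frob prim in \<open>simp_all add: \<iota>.hom_add \<iota>.hom_mult\<close>)
  show ?thesis
  proof (intro conjI exI[of _ \<delta>] exI[of _ \<theta>] allI impI ballI)
    show "3 \<le> m" by (rule m_props)
    show "\<iota> (\<delta> j) = \<gamma> ^ j + \<gamma> ^ (q * j)" for j by (rule \<delta>_eq)
    show "\<iota> (\<theta> i j k) = \<beta> k ^ (2 * i - 1) * \<gamma> ^ j + \<beta> k ^ (q * (2 * i - 1)) * \<gamma> ^ (q * j)" for i j k
      by (rule \<theta>_eq)
  next
    fix n assume n: "2 \<le> n \<and> n \<le> m - 1"
    then have n': "1 \<le> n" "n \<le> m - 1" by auto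
    show "monom 1 (2 ^ n * d) - 1 =
            [:-1, 1:] * [:1, 1:]
            * (\<Prod>j = 1..(d - 1) div 2. [:1, \<delta> j, 1:] * [:1, - \<delta> j, 1:])
            * (\<Prod>k = 2..n. \<Prod>i = 1..2 ^ (k - 2). \<Prod>j = 0..<d. [:1, - \<theta> i j k, 1:])"
      by (rule low_product[OF n'])
    then show "monom 1 (2 ^ n * d) - 1 = prod_mset (low_factors \<delta> \<theta> d n)"
      by (simp only: prod_mset_low_factors)
    show "size (low_factors \<delta> \<theta> d n) = 2 ^ (n - 1) * d + 1"
      using odd_d n'(1) by (rule size_low_factors)
    show "irreducible f" if "f \<in># low_factors \<delta> \<theta> d n" for f
      using n'(2) that by (rule irreducible_low_factors)
  next
    fix n assume n: "m \<le> n"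
    show "monom 1 (2 ^ n * d) - 1 =
            (monom 1 (2 ^ (m - 1) * d) - 1)
            * (\<Prod>r = 0..n - m. \<Prod>i = 1..2 ^ (m - 3). \<Prod>j = 0..<d.
                 (monom 1 (2 ^ (r + 1)) + monom (\<theta> i j m) (2 ^ r) - 1)
                 * (monom 1 (2 ^ (r + 1)) - monom (\<theta> i j m) (2 ^ r) - 1))"
      by (rule high_product[OF n])
    moreover have "1 \<le> m - 1" using m_props(1) by simp
    \<comment> \<open>The first factor of the high product is expanded by the low case at its
      largest exponent, \<open>m - 1\<close>.\<close>
    note low_product[OF this order_refl]
    ultimately show "monom 1 (2 ^ n * d) - 1 = prod_mset (high_factors \<delta> \<theta> d m n)"
      by (simp only: prod_mset_high_factors prod_mset_low_factors)
    show "size (high_factors \<delta> \<theta> d m n) = 2 ^ (m - 2) * d * (n - m + 2) + 1"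
      using odd_d m_props(1) by (rule size_high_factors)
    show "irreducible f" if "f \<in># high_factors \<delta> \<theta> d m n" for f
      using that by (rule irreducible_high_factors)
  qed
qed

end
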